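(* Suppose the constant area speed property: for some fixed $\mu\in\mathbb{R}$, $$\sum_{j=1}^N|\Gamma_j|\,F_j(\Gamma,t)=\mu\qquad(\Gamma\in\mathcal{O},\ t\in[0,T_* )).$$ Let $\Gamma^m\in\mathcal{O}$ ($m=1,2,\dots,\bar m$) be a solution of the implicit scheme $$\frac{\boldsymbol{h}(\Gamma^{m+1})-\boldsymbol{h}(\Gamma^m)}{\tau_m}=\boldsymbol{F}\bigl(\Gamma^{m+1/2},t_{m+1/2}\bigr)\quad(m=0,1,\dots,\bar m-1),\qquad \Gamma^0=\Gamma_*,$$ where $\Gamma_*\in\mathcal{O}$ is a given $N$-polygon, $0=t_0<t_1<\cdots<t_{\bar m}\le T$ are given time steps, $\tau_m:=t_{m+1}-t_m$, $t_{m+1/2}:=(t_m+t_{m+1})/2$ and $\Gamma^{m+1/2}:=(\Gamma^m+\Gamma^{m+1})/2\in\mathcal{P}^*$. Let $\Omega^m$ be the interior domain of $\Gamma^m$. Then $$|\Omega^{m+1}|=|\Omega^m|+\mu\,\tau_m\qquad(m=0,1,\dots,\bar m-1).$$ In other words, $|\Omega^m|=|\Omega(t_m)|$ holds if the exact solution $\Omega(t)$ of the initial value problem described in the context exists.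
   Context: $\mathcal{P}$ is the set of all polygonal Jordan curves in $\mathbb{R}^2$. For an $N$-polygon $\Gamma\in\mathcal{P}$, vertices $\boldsymbol{w}_j$ are numbered counterclockwise (indices periodic modulo $N$), $\Gamma_j$ is the open edge between $\boldsymbol{w}_{j-1}$ and $\boldsymbol{w}_j$, with length $|\Gamma_j|$ and outward unit normal $\boldsymbol{n}_j$; the outer angles at the vertices lie in $(-\pi,\pi)\setminus\{0\}$; the height of $\Gamma_j$ is $h_j:=\boldsymbol{w}_j\cdot\boldsymbol{n}_j=\boldsymbol{w}_{j-1}\cdot\boldsymbol{n}_j$; $|\Omega|$ is the area of the interior domain $\Omega$ surrounded by $\Gamma$. Polygons are equivalent if they have the same number of edges and, after suitable counterclockwise numbering, the same normals $\boldsymbol{n}_j$ for all $j$. $\mathcal{P}^*$ is a fixed equivalence class of $N$-polygons. The height function is $\boldsymbol{h}(\Gamma)=(h_1(\Gamma),\dots,h_N(\Gamma))\in\mathbb{R}^N$, and $\mathcal{P}^*$ carries the metric $d(\Gamma,\Sigma)=|\boldsymbol{h}(\Gamma)-\boldsymbol{h}(\Sigma)|_\infty$ (maximum norm). The interpolation $(\Gamma+\Sigma)/2$ is the element of $\mathcal{P}^*$ with height vector $(\boldsymbol{h}(\Gamma)+\boldsymbol{h}(\Sigma))/2$. $\mathcal{O}\subset\mathcal{P}^*$ is open, $T_*\in(0,\infty]$, $0<T<T_*$, and $\boldsymbol{F}=(F_1,\dots,F_N):\mathcal{O}\times[0,T_* )\to\mathbb{R}^N$ is a given continuous function with the local Lipschitz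 property: for every compact $\mathcal{K}\subset\mathcal{O}$ and $T\in(0,T_* )$ there is $L(\mathcal{K},T)>0$ with $|\boldsymbol{F}(\Gamma,t)-\boldsymbol{F}(\Sigma,t)|_\infty\le L(\mathcal{K},T)\,d(\Gamma,\Sigma)$ for $\Gamma,\Sigma\in\mathcal{K}$, $t\in[0,T]$. Initial value problem: for a given $N$-polygon $\Gamma^*\in\mathcal{O}$, find a $C^1$-class polygonal motion $\Gamma(t)\in\mathcal{O}$ ($0\le t\le T<T_*$) such that $V_j(t)=F_j(\Gamma(t),t)$ for $t\in[0,T]$, $j=1,\dots,N$, and $\Gamma(0)=\Gamma^*$. Here a polygonal motion $\Gamma(t)$ in $\mathcal{P}^*$ is of $C^1$-class if $t\mapsto\boldsymbol{h}(\Gamma(t))$ is $C^1$ (equivalently, all vertices are $C^1$ in $t$), $V_j(t)=\frac{d}{dt}h_j(\Gamma(t))$ is the outward normal velocity of the $j$-th edge, and $\Omega(t)$ is the interior domain of $\Gamma(t)$. *)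

theory Defs
  imports "HOL-Complex_Analysis.Complex_Analysis"
begin

text \<open>
  The plane is modelled by \<^typ>\<open>complex\<close>, so that the inner product \<open>\<bullet>\<close>, Lebesgue measure and
  winding numbers are all available.  A polygon with \<open>N\<close> edges is given by its numbered vertices,
  an \<open>N\<close>-periodic sequence \<open>w :: nat \<Rightarrow> complex\<close>; edge \<open>j \<in> {1..N}\<close> joins \<open>w (j - 1)\<close> to \<open>w j\<close>,
  with \<open>w 0 = w N\<close>.
\<close>

type_synonym polygon = "nat \<Rightarrow> complex"

primrec polyline :: "polygon \<Rightarrow> nat \<Rightarrow> real \<Rightarrow> complex" where
  "polyline w 0 = linepath (w 0) (w 1)"
| "polyline w (Suc k) = polyline w k +++ linepath (w (Suc k)) (w (Suc (Suc k)))"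

text \<open>\<open>polyline w k\<close> traverses the first \<open>k + 1\<close> edges, whence the index \<open>N - 1\<close> below.\<close>

definition boundary_path :: "nat \<Rightarrow> polygon \<Rightarrow> real \<Rightarrow> complex" where
  "boundary_path N w = polyline w (N - 1)"

definition curve :: "nat \<Rightarrow> polygon \<Rightarrow> complex set" where
  "curve N w = path_image (boundary_path N w)"

definition interior_domain :: "nat \<Rightarrow> polygon \<Rightarrow> complex set" where
  "interior_domain N w = inside (curve N w)"

definition area :: "nat \<Rightarrow> polygon \<Rightarrow> real" where
  "area N w = measure lebesgue (interior_domain N w)"

text \<open>Signed angle from the direction of edge \<open>j\<close> to that of edge \<open>j + 1\<close>.\<close>

definition outer_angle :: "polygon \<Rightarrow> nat \<Rightarrow> real" where
  "outer_angle w j = Arg ((w (j + 1) - w j) / (w j - w (j - 1)))"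

text \<open>Polygonal Jordan curves with \<open>N\<close> edges, with vertices numbered counterclockwise.\<close>

definition is_polygon :: "nat \<Rightarrow> polygon \<Rightarrow> bool" where
  "is_polygon N w \<longleftrightarrow>
     3 \<le> N \<and> (\<forall>j. w (j + N) = w j) \<and>
     simple_path (boundary_path N w) \<and>
     (\<forall>z\<in>interior_domain N w. winding_number (boundary_path N w) z = 1) \<and>
     (\<forall>j\<in>{1..N}. outer_angle w j \<in> {-pi<..<pi} - {0})"

definition edge :: "polygon \<Rightarrow> nat \<Rightarrow> complex set" where
  "edge w j = open_segment (w (j - 1)) (w j)"

definition edge_length :: "polygon \<Rightarrow> nat \<Rightarrow> real" where
  "edge_length w j = dist (w (j - 1)) (w j)"

definition is_outward_normal :: "nat \<Rightarrow> polygon \<Rightarrow> nat \<Rightarrow> complex \<Rightarrow> bool" where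
  "is_outward_normal N w j n \<longleftrightarrow>
     norm n = 1 \<and> n \<bullet> (w j - w (j - 1)) = 0 \<and>
     (\<forall>x\<in>edge w j. \<forall>\<^sub>F \<epsilon> in at_right 0. x + \<epsilon> *\<^sub>R n \<in> outside (curve N w))"

definition outward_normal :: "nat \<Rightarrow> polygon \<Rightarrow> nat \<Rightarrow> complex" where
  "outward_normal N w j = (THE n. is_outward_normal N w j n)"

definition height :: "nat \<Rightarrow> polygon \<Rightarrow> nat \<Rightarrow> real" where
  "height N w j = w j \<bullet> outward_normal N w j"

text \<open>
  The equivalence classes of \<open>polygon_equiv N\<close> play the role of \<open>\<P>\<^sup>*\<close>.  Since polygons are numbered
  here, all members of a class are numbered compatibly.  No generality is lost: the outer angles sum
  to \<open>2 * pi\<close>, so the cyclic sequence of normals has no rotational symmetry and a Jordan curve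
  has exactly one numbering with prescribed normals.
\<close>

definition polygon_equiv :: "nat \<Rightarrow> (polygon \<times> polygon) set" where
  "polygon_equiv N = {(w, v). is_polygon N w \<and> is_polygon N v \<and>
     (\<forall>j\<in>{1..N}. outward_normal N w j = outward_normal N v j)}"

definition is_polygon_class :: "nat \<Rightarrow> polygon set \<Rightarrow> bool" where
  "is_polygon_class N P \<longleftrightarrow> P \<in> {w. is_polygon N w} // polygon_equiv N"

text \<open>Vectors in \<open>\<real>\<^sup>N\<close> are functions on \<^typ>\<open>nat\<close> of which only the components \<open>1..N\<close> matter.\<close>

definition max_norm :: "nat \<Rightarrow> (nat \<Rightarrow> real) \<Rightarrow> real" where
  "max_norm N x = Max ((\<lambda>j. \<bar>x j\<bar>) ` {1..N})"

definition polygon_dist :: "nat \<Rightarrow> polygon \<Rightarrow> polygon \<Rightarrow> real" where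
  "polygon_dist N w v = max_norm N (\<lambda>j. height N w j - height N v j)"

definition polygon_topology :: "nat \<Rightarrow> polygon set \<Rightarrow> polygon topology" where
  "polygon_topology N P = Metric_space.mtopology P (polygon_dist N)"

definition time_domain :: "ereal \<Rightarrow> real set" where
  "time_domain Tstar = {t. 0 \<le> t \<and> ereal t < Tstar}"

definition continuous_velocity ::
    "nat \<Rightarrow> polygon set \<Rightarrow> polygon set \<Rightarrow> ereal \<Rightarrow> (polygon \<Rightarrow> real \<Rightarrow> nat \<Rightarrow> real) \<Rightarrow> bool" where
  "continuous_velocity N P U Tstar F \<longleftrightarrow>
     (\<forall>j\<in>{1..N}. continuous_map
        (prod_topology (subtopology (polygon_topology N P) U) (top_of_set (time_domain Tstar)))
        euclideanreal (\<lambda>(w, t). F w t j))"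

definition locally_lipschitz_velocity ::
    "nat \<Rightarrow> polygon set \<Rightarrow> polygon set \<Rightarrow> ereal \<Rightarrow> (polygon \<Rightarrow> real \<Rightarrow> nat \<Rightarrow> real) \<Rightarrow> bool" where
  "locally_lipschitz_velocity N P U Tstar F \<longleftrightarrow>
     (\<forall>K S. K \<subseteq> U \<and> compactin (polygon_topology N P) K \<and> 0 < S \<and> ereal S < Tstar \<longrightarrow>
        (\<exists>L>0. \<forall>w\<in>K. \<forall>v\<in>K. \<forall>t\<in>{0..S}.
           max_norm N (\<lambda>j. F w t j - F v t j) \<le> L * polygon_dist N w v))"

definition is_interpolation :: "nat \<Rightarrow> polygon set \<Rightarrow> polygon \<Rightarrow> polygon \<Rightarrow> polygon \<Rightarrow> bool" where
  "is_interpolation N P w v u \<longleftrightarrow>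
     u \<in> P \<and> (\<forall>j\<in>{1..N}. height N u j = (height N w j + height N v j) / 2)"

text \<open>A polygonal motion of class \<open>C\<^sup>1\<close> on \<open>[0, T]\<close> with normal velocities \<open>V\<close>; the derivatives are
  one-sided at the end points.\<close>

definition C1_polygonal_motion ::
    "nat \<Rightarrow> polygon set \<Rightarrow> real \<Rightarrow> (real \<Rightarrow> polygon) \<Rightarrow> (real \<Rightarrow> nat \<Rightarrow> real) \<Rightarrow> bool" where
  "C1_polygonal_motion N P T \<Gamma> V \<longleftrightarrow>
     (\<forall>t\<in>{0..T}. \<Gamma> t \<in> P) \<and>
     (\<forall>j\<in>{1..N}. continuous_on {0..T} (\<lambda>t. V t j) \<and>
        (\<forall>t\<in>{0..T}. ((\<lambda>s. height N (\<Gamma> s) j) has_real_derivative V t j) (at t within {0..T})))"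

definition is_ivp_solution ::
    "nat \<Rightarrow> polygon set \<Rightarrow> polygon set \<Rightarrow> (polygon \<Rightarrow> real \<Rightarrow> nat \<Rightarrow> real) \<Rightarrow> real \<Rightarrow> polygon \<Rightarrow>
      (real \<Rightarrow> polygon) \<Rightarrow> bool" where
  "is_ivp_solution N P U F T \<Gamma>0 \<Gamma> \<longleftrightarrow>
     \<Gamma> 0 = \<Gamma>0 \<and> (\<forall>t\<in>{0..T}. \<Gamma> t \<in> U) \<and>
     (\<exists>V. C1_polygonal_motion N P T \<Gamma> V \<and> (\<forall>t\<in>{0..T}. \<forall>j\<in>{1..N}. V t j = F (\<Gamma> t) t j))"

text \<open>
  \<open>\<Gamma>h m\<close> stands for \<open>\<Gamma>\<^bsup>m+1/2\<^esup>\<close>.  Heights determine a polygon within its class, so it is unique, but it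
  need not exist for arbitrary members of the class; that it exists and lies in the domain \<open>U\<close> of \<open>F\<close>
  is part of being a solution of the scheme.
\<close>

definition is_scheme_solution ::
    "nat \<Rightarrow> polygon set \<Rightarrow> polygon set \<Rightarrow> (polygon \<Rightarrow> real \<Rightarrow> nat \<Rightarrow> real) \<Rightarrow> nat \<Rightarrow> (nat \<Rightarrow> real) \<Rightarrow>
      polygon \<Rightarrow> (nat \<Rightarrow> polygon) \<Rightarrow> (nat \<Rightarrow> polygon) \<Rightarrow> bool" where
  "is_scheme_solution N P U F mbar t \<Gamma>0 \<Gamma> \<Gamma>h \<longleftrightarrow>
     \<Gamma> 0 = \<Gamma>0 \<and> (\<forall>m\<in>{1..mbar}. \<Gamma> m \<in> U) \<and>
     (\<forall>m<mbar. is_interpolation N P (\<Gamma> m) (\<Gamma> (m + 1)) (\<Gamma>h m) \<and> \<Gamma>h m \<in> U \<and>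
        (\<forall>j\<in>{1..N}. (height N (\<Gamma> (m + 1)) j - height N (\<Gamma> m) j) / (t (m + 1) - t m)
                     = F (\<Gamma>h m) ((t m + t (m + 1)) / 2) j))"

end

theory Submission
  imports Defs
begin

text \<open>
  On an equivalence class the normals are fixed, and the area is a quadratic form in the heights.
  With \<open>l\<^sub>j\<close> the length and \<open>h\<^sub>j\<close> the height of edge \<open>j\<close>, put
  \<open>M(w, v) = \<Sum>\<^sub>j l\<^sub>j(w) h\<^sub>j(v)\<close>.  Then twice the area of \<open>w\<close> is \<open>M(w, w)\<close>
  (\<open>area_mixed_sum\<close>), and \<open>M\<close> is symmetric (\<open>mixed_sum_commute\<close>), by summation by parts around the
  polygon.  The implicit scheme evaluates the velocity at the polygon with averaged heights, and this
  is what makes it exact for a quadratic form: for such a midpoint \<open>u\<close> of \<open>w\<close> and \<open>v\<close>, symmetry gives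
  \<open>M(u, v) - M(u, w) = (M(v, v) - M(w, w)) / 2\<close>, and the left-hand side is the sum of edge lengths of
  \<open>u\<close> times height increments, that is, the time step times the area speed at \<open>u\<close>
  (\<open>area_diff_eq_midpoint_sum\<close>).

  For the exact motion, symmetry of \<open>M\<close> writes an area difference as a sum of averaged edge lengths
  times height increments (\<open>area_diff_eq_sum_heights\<close>).  Edge lengths are continuous in time, because
  a vertex is the intersection of two non-parallel lines given by their heights.  So the area has
  derivative \<open>\<Sum>\<^sub>j l\<^sub>j V\<^sub>j\<close>, which the hypothesis makes constant; scheme and motion then have the same
  linear area function.

  What remains is the geometry behind \<open>area_mixed_sum\<close>, which has two parts.  The area of the inside
  equals half the shoelace sum, since the winding number is the indicator function of the inside and
  almost everywhere the sum of the winding numbers of the triangles spanned by the origin and the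
  edges (\<open>measure_inside_polyline\<close>).  The outward normal is the edge direction turned clockwise by a
  right angle, since the winding number drops by one when an edge is crossed from left to right
  (\<open>sides_of_polyline_edge\<close>, \<open>is_outward_normal_iff\<close>).
\<close>

section \<open>Winding numbers of polylines\<close>

lemma polyline_path [simp]:
  "path (polyline w k)" "pathstart (polyline w k) = w 0" "pathfinish (polyline w k) = w (Suc k)"
proof (induction k)
  case (Suc k)
  { case 1 show ?case using Suc by simp }
  { case 2 show ?case using Suc by simp }
  { case 3 show ?case using Suc by simp }
qed simp_all

lemma path_image_polyline:
  "path_image (polyline w k) = (\<Union>i\<le>k. closed_segment (w i) (w (Suc i)))"
  by (induction k) (auto simp: path_image_join atMost_Suc)

text \<open>
  Additivity of winding numbers under joining also holds for open paths, whose winding numbers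
  need not be integers.  This lets a closed polyline be cut up and reassembled edge by edge.
\<close>

lemma winding_number_polyline:
  assumes "z \<notin> path_image (polyline w k)"
  shows "winding_number (polyline w k) z = (\<Sum>i\<le>k. winding_number (linepath (w i) (w (Suc i))) z)"
  using assms
proof (induction k)
  case (Suc k)
  then have "z \<notin> path_image (polyline w k)" "z \<notin> closed_segment (w (Suc k)) (w (Suc (Suc k)))"
    by (auto simp: path_image_join)
  then show ?case
    using Suc.IH by (simp add: winding_number_join)
qed simp

lemma winding_number_linepath_swap:
  assumes "z \<notin> closed_segment a b"
  shows "winding_number (linepath b a) z = - winding_number (linepath a b) z"
  using winding_number_reversepath[of "linepath a b" z] assms by simp

lemma winding_number_three_segments:
  assumes "z \<notin> closed_segment a b" "z \<notin> closed_segment b c" "z \<notin> closed_segment c a"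
  shows "winding_number (linepath a b +++ linepath b c +++ linepath c a) z =
    winding_number (linepath a b) z + winding_number (linepath b c) z + winding_number (linepath c a) z"
  using assms by (simp add: winding_number_join path_image_join)

section \<open>The area of a polygon by the shoelace formula\<close>

text \<open>
  The planar cross product: the signed area of the parallelogram spanned by \<open>z\<close> and \<open>w\<close>, positive
  if \<open>w\<close> lies to the left of \<open>z\<close>.
\<close>

definition cross2 :: "complex \<Rightarrow> complex \<Rightarrow> real" where
  "cross2 z w = Im (cnj z * w)"

lemma cross2_simps:
  "cross2 a (b - c) = cross2 a b - cross2 a c"
  "cross2 (a - b) c = cross2 a c - cross2 b c"
  "cross2 a (r *\<^sub>R b) = r * cross2 a b"
  "cross2 (r *\<^sub>R a) b = r * cross2 a b"
  "cross2 a a = 0"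
  by (simp_all add: cross2_def algebra_simps)

lemma cross2_skew: "cross2 a b = - cross2 b a"
  by (simp add: cross2_def algebra_simps)

lemma negligible_closed_segment_complex: "negligible (closed_segment a (b::complex))"
  by (simp add: negligible_convex_interior interior_closed_segment_ge2)

text \<open>
  Identifying the coordinate plane with the complex numbers preserves Lebesgue measure, because
  boxes correspond to boxes with the same side lengths.  This carries the formula for the area of a
  triangle, \<open>content_triangle\<close>, over to complex vertices.
\<close>

lemma distr_lborel_Complex:
  "distr (lborel :: (real^2) measure) borel (\<lambda>v. Complex (vec_nth v 1) (vec_nth v 2)) = lborel"
proof (rule lborel_eqI[symmetric])
  have m: "(\<lambda>v::real^2. Complex (vec_nth v 1) (vec_nth v 2)) \<in> borel_measurable borel"
    by (intro borel_measurable_continuous_onI) (auto simp: Complex_eq intro!: continuous_intros)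
  fix l u :: complex
  assume le: "\<And>b. b \<in> Basis \<Longrightarrow> l \<bullet> b \<le> u \<bullet> b"
  let ?l = "vector [Re l, Im l] :: real^2" and ?u = "vector [Re u, Im u] :: real^2"
  have vim: "(\<lambda>v::real^2. Complex (vec_nth v 1) (vec_nth v 2)) -` box l u = box ?l ?u"
    by (auto simp: mem_box_cart forall_2 in_box_complex_iff)
  have "Re l \<le> Re u" "Im l \<le> Im u"
    using le[of 1] le[of \<i>] by (simp_all add: Basis_complex_def)
  have basis: "(Basis :: (real^2) set) = {axis 1 1, axis 2 1}"
    by (auto simp: Basis_vec_def UNIV_2)
  have "axis 1 1 \<noteq> (axis 2 1 :: real^2)"
    by (simp add: axis_eq_axis)
  with \<open>Re l \<le> Re u\<close> \<open>Im l \<le> Im u\<close> have "emeasure lborel (box ?l ?u) = ennreal ((Re u - Re l) * (Im u - Im l))"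
    by (subst emeasure_lborel_box) (auto simp: basis inner_axis)
  also have "\<dots> = ennreal (\<Prod>b\<in>Basis. (u - l) \<bullet> b)"
    by (simp add: Basis_complex_def)
  finally show "emeasure (distr lborel borel (\<lambda>v::real^2. Complex (vec_nth v 1) (vec_nth v 2))) (box l u) =
      (\<Prod>b\<in>Basis. (u - l) \<bullet> b)"
    using m vim by (simp add: emeasure_distr)
qed simp

lemma measure_triangle_complex:
  "measure lebesgue (interior (convex hull {a, b, c :: complex})) = \<bar>cross2 (b - a) (c - a)\<bar> / 2"
proof -
  define f where "f = (\<lambda>v::real^2. Complex (vec_nth v 1) (vec_nth v 2))"
  define g where "g = (\<lambda>z. vector [Re z, Im z] :: real^2)"
  have m: "f \<in> borel_measurable borel"
    unfolding f_def
    by (intro borel_measurable_continuous_onI) (auto simp: Complex_eq intro!: continuous_intros)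
  have lin: "linear f"
    by (rule linearI) (auto simp: f_def complex_eq_iff)
  have fg: "f (g z) = z" for z by (simp add: f_def g_def)
  have gf: "g (f z) = z" for z by (simp add: f_def g_def vec_eq_iff forall_2)
  have inj: "inj f" by (metis gf injI)
  have "f ` (convex hull {g a, g b, g c}) = convex hull {a, b, c}"
    using convex_hull_linear_image[OF lin, of "{g a, g b, g c}"] by (simp add: fg)
  then have vim: "f -` (convex hull {a, b, c}) = convex hull {g a, g b, g c}"
    using inj by (metis inj_vimage_image_eq)
  have comp: "compact (convex hull {a, b, c})"
    by (simp add: finite_imp_compact_convex_hull)
  then have B: "convex hull {a, b, c} \<in> sets borel"
    by (simp add: borel_compact)
  have "measure lebesgue (interior (convex hull {a, b, c})) = measure lebesgue (convex hull {a, b, c})"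
    by (rule measure_interior) (auto simp: compact_imp_bounded comp negligible_convex_frontier)
  also have "\<dots> = measure (distr lborel borel f) (convex hull {a, b, c})"
    using B by (simp add: f_def distr_lborel_Complex measure_completion)
  also have "\<dots> = measure lborel (convex hull {g a, g b, g c})"
    using B m vim by (simp add: measure_distr)
  also have "\<dots> = \<bar>cross2 (b - a) (c - a)\<bar> / 2"
    by (simp add: content_triangle g_def cross2_def algebra_simps abs_minus_commute)
  finally show ?thesis .
qed

text \<open>
  A triangle is traversed counterclockwise exactly when its cross product is positive.  Excluding
  the frontier of the convex hull covers degenerate triangles as well: their interior is empty, and
  a point off the hull has winding number zero.
\<close>

lemma winding_number_origin_triangle:
  assumes "z \<notin> frontier (convex hull {0, a, b})"
  shows "winding_number (linepath 0 a +++ linepath a b +++ linepath b 0) z =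
     of_real (sgn (cross2 a b) * indicator (interior (convex hull {0, a, b})) z)"
proof (cases "z \<in> interior (convex hull {0, a, b})")
  case True
  \<comment> \<open>The barycentric coordinates of an interior point relate the sign test of the winding number to the cross product.\<close>
  have nc: "\<not> collinear {0, a, b}"
  proof
    assume "collinear {0, a, b}"
    then have "interior (convex hull {0, a, b}) = {}"
      using aff_dim_nonempty_interior[of "convex hull {0, a, b}"]
      by (force simp: collinear_aff_dim aff_dim_convex_hull)
    with True show False by simp
  qed
  then obtain x y t where xyt: "0 < t" "z = y *\<^sub>R a + t *\<^sub>R b"
    using True interior_convex_hull_3_minimal[OF nc] by auto
  have "Im ((a - 0) * cnj (a - z)) = t * cross2 a b"
    by (simp add: xyt cross2_def algebra_simps)
  moreover have "cross2 a b \<noteq> 0"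
  proof
    assume "cross2 a b = 0"
    then have "measure lebesgue (interior (convex hull {0, a, b})) = 0"
      by (simp add: measure_triangle_complex)
    moreover have "interior (convex hull {0, a, b}) \<in> lmeasurable"
      by (simp add: lmeasurable_interior compact_imp_bounded finite_imp_compact_convex_hull)
    ultimately have "negligible (interior (convex hull {0, a, b}))"
      by (simp add: negligible_iff_measure)
    with True show False
      using open_not_negligible[OF open_interior] by (metis empty_iff)
  qed
  moreover have "winding_number (linepath 0 a +++ linepath a b +++ linepath b 0) z =
      (if 0 < Im ((a - 0) * cnj (a - z)) then 1 else -1)"
    by (rule winding_number_triangle[OF True])
  ultimately show ?thesis
    using True xyt(1) by (simp add: zero_less_mult_iff sgn_if)
next
  case False
  then have "z \<notin> convex hull {0, a, b}"
    using assms False closure_subset[of "convex hull {0, a, b}"] unfolding frontier_def by blast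
  moreover have "path_image (linepath 0 a +++ linepath a b +++ linepath b 0) \<subseteq> convex hull {0, a, b}"
    by (simp add: path_image_join closed_segment_subset_convex_hull hull_inc)
  ultimately show ?thesis
    using False by (simp add: winding_number_zero_outside[where s = "convex hull {0, a, b}"])
qed

text \<open>
  The triangle with vertices \<open>0\<close>, \<open>w i\<close>, \<open>w (Suc i)\<close> contributes edge \<open>i\<close> together with two
  radial sides.  Neighbouring triangles traverse a common radial side in opposite directions, so these
  contributions telescope to zero along a closed polyline.
\<close>

lemma winding_number_closed_polyline_eq_triangles:
  assumes closed: "w (Suc k) = w 0"
    and z: "z \<notin> path_image (polyline w k)" "\<And>i. z \<notin> closed_segment 0 (w i)"
      "\<And>i. z \<notin> frontier (convex hull {0, w i, w (Suc i)})"
  shows "winding_number (polyline w k) z =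
    of_real (\<Sum>i\<le>k. sgn (cross2 (w i) (w (Suc i))) * indicator (interior (convex hull {0, w i, w (Suc i)})) z)"
proof -
  define r where "r i = winding_number (linepath 0 (w i)) z" for i
  have "(\<Sum>i\<le>k. winding_number (linepath (w i) (w (Suc i))) z) =
    (\<Sum>i\<le>k. of_real (sgn (cross2 (w i) (w (Suc i))) * indicator (interior (convex hull {0, w i, w (Suc i)})) z)
        + (r (Suc i) - r i))"
  proof (rule sum.cong)
    fix i assume "i \<in> {..k}"
    with z(1) have zi: "z \<notin> closed_segment (w i) (w (Suc i))"
      by (auto simp: path_image_polyline)
    have zs: "z \<notin> closed_segment (w (Suc i)) 0"
      using z(2)[of "Suc i"] by (simp add: closed_segment_commute)
    show "winding_number (linepath (w i) (w (Suc i))) z =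
       of_real (sgn (cross2 (w i) (w (Suc i))) * indicator (interior (convex hull {0, w i, w (Suc i)})) z)
        + (r (Suc i) - r i)"
      using winding_number_origin_triangle[OF z(3)[of i]]
        winding_number_three_segments[OF z(2)[of i] zi zs]
        winding_number_linepath_swap[OF z(2)[of "Suc i"]]
      by (simp add: r_def algebra_simps)
  qed simp
  also have "\<dots> = of_real (\<Sum>i\<le>k. sgn (cross2 (w i) (w (Suc i))) *
      indicator (interior (convex hull {0, w i, w (Suc i)})) z) + (\<Sum>i\<le>k. r (Suc i) - r i)"
    by (simp only: sum.distrib of_real_sum)
  also have "(\<Sum>i\<le>k. r (Suc i) - r i) = r (Suc k) - r 0"
    using sum_lessThan_telescope[of r "Suc k"] by (simp add: lessThan_Suc_atMost)
  also have "\<dots> = 0"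
    by (simp add: r_def closed)
  finally show ?thesis
    using winding_number_polyline[OF z(1)] by simp
qed

lemma winding_number_closed_polyline_indicator:
  assumes closed: "w (Suc k) = w 0"
    and wn: "\<And>z. z \<in> inside (path_image (polyline w k)) \<Longrightarrow> winding_number (polyline w k) z = 1"
    and z: "z \<notin> path_image (polyline w k)"
  shows "winding_number (polyline w k) z = of_real (indicator (inside (path_image (polyline w k))) z)"
proof (cases "z \<in> inside (path_image (polyline w k))")
  case False
  then have "z \<in> outside (path_image (polyline w k))"
    using z inside_Un_outside by blast
  then show ?thesis
    using False by (simp add: winding_number_zero_in_outside closed)
qed (simp add: wn)

text \<open>
  Integrating the winding number over the plane, in the two forms given by the preceding two lemmas,
  yields the area of the inside and the signed areas of the triangles respectively.
\<close>

lemma measure_inside_polyline: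
  assumes closed: "w (Suc k) = w 0"
    and wn: "\<And>z. z \<in> inside (path_image (polyline w k)) \<Longrightarrow> winding_number (polyline w k) z = 1"
  shows "measure lebesgue (inside (path_image (polyline w k))) = (\<Sum>i\<le>k. cross2 (w i) (w (Suc i))) / 2"
proof -
  let ?T = "\<lambda>i. interior (convex hull {0, w i, w (Suc i)})"
  let ?I = "inside (path_image (polyline w k))"
  \<comment> \<open>the null set on which the decomposition into triangles may fail\<close>
  define E where "E = path_image (polyline w k) \<union> (\<Union>i. closed_segment 0 (w i)) \<union>
     (\<Union>i. frontier (convex hull {0, w i, w (Suc i)}))"
  have "negligible (path_image (polyline w k))"
    unfolding path_image_polyline
    by (intro negligible_Union) (auto simp: negligible_closed_segment_complex)
  moreover have "negligible (\<Union>i. closed_segment 0 (w i))"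
    by (intro negligible_countable_Union) (auto simp: negligible_closed_segment_complex)
  moreover have "negligible (\<Union>i. frontier (convex hull {0, w i, w (Suc i)}))"
    by (intro negligible_countable_Union) (auto simp: negligible_convex_frontier)
  ultimately have "negligible E"
    by (simp add: E_def)
  moreover have "indicator ?I z = (\<Sum>i\<le>k. sgn (cross2 (w i) (w (Suc i))) * indicator (?T i) z)"
    if "z \<in> UNIV - E" for z
  proof -
    have z: "z \<notin> path_image (polyline w k)" "\<And>i. z \<notin> closed_segment 0 (w i)"
      "\<And>i. z \<notin> frontier (convex hull {0, w i, w (Suc i)})"
      using that by (auto simp: E_def)
    have "winding_number (polyline w k) z = of_real (indicator ?I z)"
      using winding_number_closed_polyline_indicator[OF closed wn z(1)] .
    then show ?thesis
      unfolding winding_number_closed_polyline_eq_triangles[OF closed z] of_real_eq_iff by (rule sym)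
  qed
  moreover have "((\<lambda>z. \<Sum>i\<le>k. sgn (cross2 (w i) (w (Suc i))) * indicator (?T i) z) has_integral
      (\<Sum>i\<le>k. sgn (cross2 (w i) (w (Suc i))) * measure lebesgue (?T i))) UNIV"
  proof (intro has_integral_sum has_integral_mult_right)
    fix i
    have "?T i \<in> lmeasurable"
      by (simp add: lmeasurable_interior compact_imp_bounded finite_imp_compact_convex_hull)
    then show "(indicat_real (?T i) has_integral measure lebesgue (?T i)) UNIV"
      by (simp add: lmeasurable_iff_has_integral)
  qed simp
  ultimately have "(indicat_real ?I has_integral
      (\<Sum>i\<le>k. sgn (cross2 (w i) (w (Suc i))) * measure lebesgue (?T i))) UNIV"
    by (rule has_integral_spike)
  moreover have "?I \<in> lmeasurable"
    by (intro lmeasurable_open bounded_inside open_inside bounded_path_image closed_path_image)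
       simp_all
  then have "(indicat_real ?I has_integral measure lebesgue ?I) UNIV"
    by (simp add: lmeasurable_iff_has_integral)
  ultimately have "measure lebesgue ?I = (\<Sum>i\<le>k. sgn (cross2 (w i) (w (Suc i))) * measure lebesgue (?T i))"
    using has_integral_unique by blast
  also have "\<dots> = (\<Sum>i\<le>k. cross2 (w i) (w (Suc i)) / 2)"
    by (simp add: measure_triangle_complex sgn_mult_abs)
  finally show ?thesis
    by (simp add: sum_divide_distrib)
qed

section \<open>Edges of simple closed polylines\<close>

text \<open>
  An edge appended to an arc meets what is there already only in the vertex where it is attached.
  Edges that are not adjacent are in fact disjoint, since their common point \<open>w j\<close> would also lie on
  edge \<open>j - 1\<close>, which meets edge \<open>i\<close> at most in \<open>w (j - 1)\<close>.
\<close>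

lemma arc_polyline_segments_meet:
  assumes "arc (polyline w k)" "i < j" "j \<le> k"
  shows "closed_segment (w i) (w (Suc i)) \<inter> closed_segment (w j) (w (Suc j)) \<subseteq> {w j}"
  using assms
proof (induction k)
  case (Suc k)
  then have *: "arc (polyline w k)"
    "path_image (polyline w k) \<inter> closed_segment (w (Suc k)) (w (Suc (Suc k))) \<subseteq> {w (Suc k)}"
    by (simp_all add: arc_join_eq)
  show ?case
  proof (cases "j = Suc k")
    case True
    then show ?thesis
      using *(2) \<open>i < j\<close> unfolding path_image_polyline by (blast intro: less_Suc_eq_le[THEN iffD1])
  next
    case False
    then show ?thesis
      using * Suc by simp
  qed
qed simp

lemma arc_polyline_vertex_neq:
  assumes "arc (polyline w k)" "i \<le> k"
  shows "w i \<noteq> w (Suc i)"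
  using assms
proof (induction k)
  case (Suc k)
  then have "arc (polyline w k)" "arc (linepath (w (Suc k)) (w (Suc (Suc k))))"
    by (simp_all add: arc_join_eq)
  then show ?case
    using Suc arc_distinct_ends[of "linepath (w (Suc k)) (w (Suc (Suc k)))"]
    by (cases "i = Suc k") (simp_all add: le_Suc_eq)
qed (use arc_distinct_ends in force)

lemma arc_polyline_open_segment_disjoint:
  assumes arc: "arc (polyline w k)" and "i \<le> k" "j \<le> k" "i \<noteq> j"
  shows "open_segment (w i) (w (Suc i)) \<inter> closed_segment (w j) (w (Suc j)) = {}"
proof (cases "j < i")
  case True
  then show ?thesis
    using arc_polyline_segments_meet[OF arc True \<open>i \<le> k\<close>] by (auto simp: open_segment_def)
next
  case False
  then have "i < j" using \<open>i \<noteq> j\<close> by simp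
  have "w j \<notin> open_segment (w i) (w (Suc i))"
  proof (cases "j = Suc i")
    case False
    then obtain l where l: "j = Suc l" "i < l"
      using \<open>i < j\<close> by (cases j) auto
    then have "w j \<notin> closed_segment (w i) (w (Suc i))"
      using arc_polyline_segments_meet[OF arc \<open>i < l\<close>] arc_polyline_vertex_neq[OF arc, of l] \<open>j \<le> k\<close>
      by auto
    then show ?thesis by (simp add: open_segment_def)
  qed (simp add: open_segment_def)
  then show ?thesis
    using arc_polyline_segments_meet[OF arc \<open>i < j\<close> \<open>j \<le> k\<close>] segment_open_subset_closed by blast
qed

text \<open>
  Removing the last edge of a simple closed polyline leaves an arc, which the last edge meets only in
  its two end points.  The edges of the arc are handled by the preceding lemmas, and the last edge is
  compared with them separately.
\<close>

lemma simple_closed_polyline: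
  assumes simple: "simple_path (polyline w (Suc k))" and closed: "w (Suc (Suc k)) = w 0"
  shows "i \<le> Suc k \<Longrightarrow> w i \<noteq> w (Suc i)"
    and "i \<le> Suc k \<Longrightarrow> j \<le> Suc k \<Longrightarrow> i \<noteq> j \<Longrightarrow>
      open_segment (w i) (w (Suc i)) \<inter> closed_segment (w j) (w (Suc j)) = {}"
proof -
  have *: "arc (polyline w k)" "arc (linepath (w (Suc k)) (w (Suc (Suc k))))"
    "path_image (polyline w k) \<inter> closed_segment (w (Suc k)) (w (Suc (Suc k))) \<subseteq> {w 0, w (Suc k)}"
    using simple closed by (simp_all add: simple_path_join_loop_eq)
  have last: "w (Suc k) \<noteq> w (Suc (Suc k))"
    using arc_distinct_ends[OF *(2)] by simp
  then show neq: "w i \<noteq> w (Suc i)" if "i \<le> Suc k" for i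
    using arc_polyline_vertex_neq[OF *(1), of i] that by (cases "i = Suc k") (simp_all add: le_Suc_eq)
  have end_notin: "w (Suc k) \<notin> open_segment (w i) (w (Suc i))" if "i \<le> k" for i
  proof (cases "i = k")
    case False
    then have "i < k" using that by simp
    then have "w (Suc k) \<notin> closed_segment (w i) (w (Suc i))"
      using arc_polyline_segments_meet[OF *(1) \<open>i < k\<close>] neq[of k] by auto
    then show ?thesis by (simp add: open_segment_def)
  qed (simp add: open_segment_def)
  have start_notin: "w 0 \<notin> open_segment (w i) (w (Suc i))" if "i \<le> k" for i
  proof (cases "i = 0")
    case False
    then have "w 0 \<in> closed_segment (w i) (w (Suc i)) \<Longrightarrow> w 0 = w i"
      using arc_polyline_segments_meet[OF *(1), of 0 i] that by auto
    then show ?thesis by (auto simp: open_segment_def)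
  qed (simp add: open_segment_def)
  show "open_segment (w i) (w (Suc i)) \<inter> closed_segment (w j) (w (Suc j)) = {}"
    if ij: "i \<le> Suc k" "j \<le> Suc k" "i \<noteq> j"
  proof -
    consider "i \<le> k" "j \<le> k" | "i = Suc k" "j \<le> k" | "i \<le> k" "j = Suc k"
      using ij by (metis le_Suc_eq)
    then show ?thesis
    proof cases
      case 1
      then show ?thesis
        using arc_polyline_open_segment_disjoint[OF *(1)] ij(3) by blast
    next
      case 2
      then have "closed_segment (w j) (w (Suc j)) \<subseteq> path_image (polyline w k)"
        by (auto simp: path_image_polyline)
      then show ?thesis
        using *(3) 2 closed by (auto simp: open_segment_def)
    next
      case 3
      then have "open_segment (w i) (w (Suc i)) \<subseteq> path_image (polyline w k)"
        using segment_open_subset_closed[of "w i" "w (Suc i)"] unfolding path_image_polyline by blast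
      then show ?thesis
        using *(3) 3 end_notin[of i] start_notin[of i] by blast
    qed
  qed
qed

section \<open>Outward normals\<close>

text \<open>
  A small step to the left of an edge stays inside the triangle erected over that edge.
\<close>

lemma interior_triangle_on_left:
  fixes a b x u :: complex
  defines "u \<equiv> sgn (b - a)"
  assumes "x \<in> open_segment a b" "0 < e" "e < 1"
  shows "x + e *\<^sub>R (\<i> * u) \<in> interior (convex hull {a, b, x + \<i> * u})"
proof -
  from assms obtain s where s: "0 < s" "s < 1" "x = (1 - s) *\<^sub>R a + s *\<^sub>R b" and "a \<noteq> b"
    by (auto simp: in_segment)
  define c where "c = x + \<i> * u"
  have u: "u \<noteq> 0" "b - a = norm (b - a) *\<^sub>R u"
    using \<open>a \<noteq> b\<close> by (auto simp: u_def sgn_zero_iff scaleR_conv_of_real sgn_div_norm)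
  have "\<not> collinear {a, b, c}"
  proof
    assume "collinear {a, b, c}"
    then obtain p q where "p + q = 1" and c: "c = p *\<^sub>R a + q *\<^sub>R b"
      using \<open>a \<noteq> b\<close> by (auto simp: collinear_3_affine_hull affine_hull_2)
    then have "p = 1 - q" by simp
    have "\<i> * u = c - x"
      by (simp add: c_def)
    also have "\<dots> = (q - s) *\<^sub>R (b - a)"
      unfolding c s(3) \<open>p = 1 - q\<close> by (simp add: algebra_simps)
    also have "\<dots> = of_real ((q - s) * norm (b - a)) * u"
      using u(2) by (metis of_real_mult mult.assoc scaleR_conv_of_real)
    finally have "\<i> = of_real ((q - s) * norm (b - a))"
      using u(1) by simp
    then show False
      by (metis Im_complex_of_real imaginary_unit.simps(2) zero_neq_one)
  qed
  moreover have "x + e *\<^sub>R (\<i> * u) = ((1 - e) * (1 - s)) *\<^sub>R a + ((1 - e) * s) *\<^sub>R b + e *\<^sub>R c"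
    by (simp add: c_def s(3) scaleR_conv_of_real algebra_simps)
  moreover have "0 < (1 - e) * (1 - s)" "0 < (1 - e) * s"
    using s assms by simp_all
  moreover have "(1 - e) * (1 - s) + (1 - e) * s + e = 1"
    by (simp add: algebra_simps)
  ultimately show ?thesis
    unfolding c_def using \<open>0 < e\<close> by (subst interior_convex_hull_3_minimal) (auto simp: DIM_complex)
qed

text \<open>
  Replace the edge from \<open>a\<close> to \<open>b\<close> by the detour over a point \<open>c\<close> on its left.  The polyline so
  obtained avoids \<open>x\<close>, so its winding number is continuous at \<open>x\<close>; the triangle \<open>a, b, c\<close>
  that makes up the difference has winding number one just to the left of \<open>x\<close> and zero just to the
  right.  Hence the winding number of the original polyline jumps by one across the edge.  Since it
  takes only the values zero outside and one inside, the left side is inside and the right side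
  outside.
\<close>

lemma sides_of_polyline_edge:
  assumes closed: "w (Suc k) = w 0"
    and wn: "\<And>z. z \<in> inside (path_image (polyline w k)) \<Longrightarrow> winding_number (polyline w k) z = 1"
    and i: "i \<le> k" and x: "x \<in> open_segment (w i) (w (Suc i))"
    and only: "\<And>j. j \<le> k \<Longrightarrow> j \<noteq> i \<Longrightarrow> x \<notin> closed_segment (w j) (w (Suc j))"
  defines "u \<equiv> sgn (w (Suc i) - w i)"
  shows "\<forall>\<^sub>F e in at_right 0. x + e *\<^sub>R (- \<i> * u) \<in> outside (path_image (polyline w k)) \<and>
     x + e *\<^sub>R (\<i> * u) \<in> inside (path_image (polyline w k))"
proof -
  define a b c where "a = w i" and "b = w (Suc i)" and "c = x + \<i> * u"
  define S where "S = path_image (polyline w k)"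
  define C where "C = (\<Union>j\<in>{..k} - {i}. closed_segment (w j) (w (Suc j))) \<union> closed_segment a c \<union> closed_segment c b"
  \<comment> \<open>the winding number of the polyline with the detour\<close>
  define g where "g z = (\<Sum>j\<in>{..k} - {i}. winding_number (linepath (w j) (w (Suc j))) z)
    + (winding_number (linepath a c) z + winding_number (linepath c b) z)" for z
  \<comment> \<open>the signed distance from the line through the edge, positive on the left\<close>
  define L where "L z = Im (cnj u * (z - x))" for z
  obtain s where s: "0 < s" "s < 1" "x = (1 - s) *\<^sub>R a + s *\<^sub>R b" and "a \<noteq> b"
    using x by (auto simp: in_segment a_def b_def)
  have u: "b - a = norm (b - a) *\<^sub>R u" "norm u = 1"
    using \<open>a \<noteq> b\<close> by (auto simp: u_def a_def b_def sgn_div_norm norm_sgn)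
  have cnju: "cnj u * u = 1"
    using u(2) by (simp add: complex_norm_square[symmetric] mult.commute)
  have xb: "b - x = ((1 - s) * norm (b - a)) *\<^sub>R u"
  proof -
    have "b - x = (1 - s) *\<^sub>R (b - a)" by (simp add: s(3) algebra_simps)
    then show ?thesis using u(1) by (metis scaleR_scaleR)
  qed
  have xa: "a - x = (- s * norm (b - a)) *\<^sub>R u"
  proof -
    have "a - x = (- s) *\<^sub>R (b - a)" by (simp add: s(3) algebra_simps)
    then show ?thesis using u(1) by (metis scaleR_scaleR)
  qed
  have Lu: "L (x + r *\<^sub>R u) = 0" "L (x + r *\<^sub>R (\<i> * u)) = r" for r
    using cnju by (simp_all add: L_def mult.left_commute)
  have La: "L a = 0" and Lb: "L b = 0"
    using Lu(1) xa xb by (metis add.commute diff_add_cancel)+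
  have Lc: "L c = 1"
    using Lu(2)[of 1] by (simp add: c_def)
  have Lconv: "L ((1 - t) *\<^sub>R p + t *\<^sub>R q) = (1 - t) * L p + t * L q" for t p q
    by (simp add: L_def algebra_simps)
  have Lx: "L x = 0" by (simp add: L_def)
  have xab: "x \<noteq> a" "x \<noteq> b"
    using x by (auto simp: a_def b_def open_segment_def)
  have "x \<notin> closed_segment a c"
  proof
    assume "x \<in> closed_segment a c"
    then obtain t where "x = (1 - t) *\<^sub>R a + t *\<^sub>R c" by (auto simp: in_segment)
    with Lconv[of t a c] La Lc Lx have "t = 0" by simp
    with \<open>x = (1 - t) *\<^sub>R a + t *\<^sub>R c\<close> xab show False by simp
  qed
  moreover have "x \<notin> closed_segment c b"
  proof
    assume "x \<in> closed_segment c b"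
    then obtain t where "x = (1 - t) *\<^sub>R c + t *\<^sub>R b" by (auto simp: in_segment)
    with Lconv[of t c b] Lb Lc Lx have "t = 1" by simp
    with \<open>x = (1 - t) *\<^sub>R c + t *\<^sub>R b\<close> xab show False by simp
  qed
  ultimately have "x \<notin> C"
    using only by (auto simp: C_def)
  have "closed C"
    by (auto simp: C_def intro!: closed_Un closed_UN)
  then have "\<forall>\<^sub>F z in nhds x. z \<notin> C"
    using \<open>x \<notin> C\<close> eventually_nhds_in_open[of "- C" x] by (simp add: open_Compl)
  moreover have "isCont g x"
    unfolding g_def
    using \<open>x \<notin> C\<close> by (intro continuous_intros continuous_at_winding_number) (auto simp: C_def)
  then have "\<forall>\<^sub>F z in nhds x. dist (g z) (g x) < 1/2"
    using tendstoD[of g "g x" "nhds x" "1/2"] by (simp add: isCont_def tendsto_at_iff_tendsto_nhds)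
  ultimately have near: "\<forall>\<^sub>F z in nhds x. z \<notin> C \<and> dist (g z) (g x) < 1/2"
    by eventually_elim simp
  have lim: "((\<lambda>e. x + e *\<^sub>R v) \<longlongrightarrow> x) (at_right 0)" for v
    by (rule tendsto_eq_intros refl | simp)+
  have split: "winding_number (polyline w k) z =
      g z + winding_number (linepath a b +++ linepath b c +++ linepath c a) z"
    and notin: "z \<notin> S"
    if z: "z \<notin> C" "L z \<noteq> 0" for z
  proof -
    have "z \<notin> closed_segment a b"
      using z(2) Lconv La Lb by (auto simp: in_segment)
    moreover have others: "z \<notin> closed_segment (w j) (w (Suc j))" if "j \<le> k" "j \<noteq> i" for j
      using z(1) that by (auto simp: C_def)
    ultimately show "z \<notin> S"
      unfolding S_def path_image_polyline a_def b_def by auto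
    have "z \<notin> closed_segment c a" "z \<notin> closed_segment b c"
      using z(1) by (auto simp: C_def closed_segment_commute)
    note tri = winding_number_three_segments[OF \<open>z \<notin> closed_segment a b\<close> this(2,1)]
    show "winding_number (polyline w k) z =
      g z + winding_number (linepath a b +++ linepath b c +++ linepath c a) z"
      unfolding tri winding_number_polyline[OF \<open>z \<notin> S\<close>[unfolded S_def]] g_def
      using i winding_number_linepath_swap[OF \<open>z \<notin> closed_segment c a\<close>]
        winding_number_linepath_swap[OF \<open>z \<notin> closed_segment b c\<close>]
      by (simp add: sum.remove[of "{..k}" i] a_def b_def)
  qed
  have wn01: "winding_number (polyline w k) z = (if z \<in> inside S then 1 else 0)" if "z \<notin> S" for z
    using winding_number_closed_polyline_indicator[OF closed wn, of z] that
    by (simp add: S_def indicator_def)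
  have "\<forall>\<^sub>F e in at_right (0::real). 0 < e \<and> e < 1"
    by (simp add: eventually_at_right_less eventually_conj eventually_at_right[of 0 1] exI[of _ 1])
  moreover have "\<forall>\<^sub>F e in at_right 0. x + e *\<^sub>R (- \<i> * u) \<notin> C \<and> dist (g (x + e *\<^sub>R (- \<i> * u))) (g x) < 1/2"
    using near lim by (rule eventually_compose_filterlim)
  moreover have "\<forall>\<^sub>F e in at_right 0. x + e *\<^sub>R (\<i> * u) \<notin> C \<and> dist (g (x + e *\<^sub>R (\<i> * u))) (g x) < 1/2"
    using near lim by (rule eventually_compose_filterlim)
  ultimately show ?thesis
  proof eventually_elim
    case (elim e)
    define l r where "l = x + e *\<^sub>R (\<i> * u)" and "r = x + e *\<^sub>R (- \<i> * u)"
    have L: "L l = e" "L r = - e"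
      using Lu(2)[of e] Lu(2)[of "-e"] by (simp_all add: l_def r_def)
    \<comment> \<open>The triangle lies in the closed half-plane to the left of the edge.\<close>
    have "r \<notin> {z. 0 \<le> L z}"
      using L elim by simp
    moreover have conv: "convex {z. 0 \<le> L z}"
    proof (rule convexI)
      fix p q and s t :: real
      assume "p \<in> {z. 0 \<le> L z}" "q \<in> {z. 0 \<le> L z}" "0 \<le> s" "0 \<le> t" "s + t = 1"
      then show "s *\<^sub>R p + t *\<^sub>R q \<in> {z. 0 \<le> L z}"
        using Lconv[of t p q] by (simp add: eq_diff_eq[symmetric])
    qed
    moreover have "path_image (linepath a b +++ linepath b c +++ linepath c a) \<subseteq> {z. 0 \<le> L z}"
      using La Lb Lc by (simp add: path_image_join closed_segment_subset[OF _ _ conv])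
    ultimately have "winding_number (linepath a b +++ linepath b c +++ linepath c a) r = 0"
      by (intro winding_number_zero_outside[where s = "{z. 0 \<le> L z}"]) simp_all
    then have wr: "winding_number (polyline w k) r = g r" and "r \<notin> S"
      using split[of r] notin[of r] elim L by (simp_all add: r_def)
    have "l \<in> interior (convex hull {a, b, c})"
      using interior_triangle_on_left[OF x, of e] elim by (simp add: a_def b_def c_def l_def u_def)
    moreover have "0 < Im ((b - a) * cnj (b - l))"
    proof -
      have "Im (cnj u * (b - l)) = L b - L l"
        by (simp add: L_def algebra_simps)
      moreover have "Im ((b - a) * cnj (b - l)) = - (norm (b - a) * Im (cnj u * (b - l)))"
        by (subst u(1)) (simp add: algebra_simps)
      ultimately show ?thesis
        using L Lb elim \<open>a \<noteq> b\<close> by simp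
    qed
    ultimately have "winding_number (linepath a b +++ linepath b c +++ linepath c a) l = 1"
      by (simp add: winding_number_triangle)
    then have wl: "winding_number (polyline w k) l = g l + 1" and "l \<notin> S"
      using split[of l] notin[of l] elim L by (simp_all add: l_def)
    have gl: "g l = winding_number (polyline w k) l - 1"
      by (simp add: wl)
    have "dist (g r) (g l) < 1"
      using dist_triangle_half_l[of "g r" "g x" 1 "g l"] elim by (simp add: l_def r_def dist_commute)
    then have "r \<notin> inside S \<and> l \<in> inside S"
      unfolding gl wr[symmetric] wn01[OF \<open>r \<notin> S\<close>] wn01[OF \<open>l \<notin> S\<close>]
      by (auto simp: dist_norm split: if_splits)
    then have "r \<in> outside S" "l \<in> inside S"
      using \<open>r \<notin> S\<close> inside_Un_outside[of S] by blast+
    then show ?case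
      by (simp add: S_def l_def r_def)
  qed
qed

text \<open>
  The number of edges enters as \<open>N - 1\<close> because \<open>polyline w k\<close> has \<open>k + 1\<close> edges.
\<close>

lemma is_polygonD:
  assumes "is_polygon N w"
  shows "3 \<le> N" "w (j + N) = w j" "w N = w 0"
    "simple_path (polyline w (N - 1))" "w (Suc (N - 1)) = w 0"
    "z \<in> inside (path_image (polyline w (N - 1))) \<Longrightarrow> winding_number (polyline w (N - 1)) z = 1"
    "i \<in> {1..N} \<Longrightarrow> outer_angle w i \<notin> {0, pi}"
proof -
  show "3 \<le> N" "w (j + N) = w j" "w N = w 0"
    using assms by (auto simp: is_polygon_def) (metis add_0)
  then show "w (Suc (N - 1)) = w 0" by simp
  show "simple_path (polyline w (N - 1))"
    "z \<in> inside (path_image (polyline w (N - 1))) \<Longrightarrow> winding_number (polyline w (N - 1)) z = 1"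
    using assms by (auto simp: is_polygon_def boundary_path_def interior_domain_def curve_def)
  show "i \<in> {1..N} \<Longrightarrow> outer_angle w i \<notin> {0, pi}"
    using assms unfolding is_polygon_def by fastforce
qed

lemma is_polygon_edges:
  assumes w: "is_polygon N w" and i: "i \<le> N - 1"
  shows "w i \<noteq> w (Suc i)"
    and "j \<le> N - 1 \<Longrightarrow> i \<noteq> j \<Longrightarrow> open_segment (w i) (w (Suc i)) \<inter> closed_segment (w j) (w (Suc j)) = {}"
proof -
  obtain k where N: "N - 1 = Suc k"
    using is_polygonD(1)[OF w] by (cases "N - 1") auto
  note D = is_polygonD(4,5)[OF w, unfolded N]
  show "w i \<noteq> w (Suc i)"
    using simple_closed_polyline(1)[OF D] i N by simp
  show "open_segment (w i) (w (Suc i)) \<inter> closed_segment (w j) (w (Suc j)) = {}"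
    if "j \<le> N - 1" "i \<noteq> j"
    using simple_closed_polyline(2)[OF D] i that N by simp
qed

lemma inner_eq_cross2: "a \<bullet> (- \<i> * d) = cross2 a d"
  by (simp add: cross2_def inner_complex_def)

text \<open>
  A unit vector orthogonal to the edge points either left or right of it, and by
  \<open>sides_of_polyline_edge\<close> only the right-hand one leads into the outside.  This holds at every point
  of the edge; excluding the left-hand one takes a single point, for which the midpoint serves.
\<close>

lemma is_outward_normal_iff:
  assumes w: "is_polygon N w" and j: "j \<in> {1..N}"
  shows "is_outward_normal N w j n \<longleftrightarrow> n = - \<i> * sgn (w j - w (j - 1))"
proof -
  obtain i where i: "j = Suc i" "i \<le> N - 1"
    using j by (cases j) auto
  define d u where "d = w (Suc i) - w i" and "u = sgn d"
  have neq: "w i \<noteq> w (Suc i)"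
    using is_polygon_edges(1)[OF w i(2)] .
  then have nu: "norm u = 1" and du: "d = norm d *\<^sub>R u" and "0 < norm d"
    by (auto simp: u_def d_def norm_sgn sgn_div_norm)
  have sides: "\<forall>\<^sub>F e in at_right 0. x + e *\<^sub>R (- \<i> * u) \<in> outside (curve N w) \<and>
     x + e *\<^sub>R (\<i> * u) \<in> inside (curve N w)" if "x \<in> edge w j" for x
    unfolding u_def d_def curve_def boundary_path_def
  proof (rule sides_of_polyline_edge)
    show "x \<in> open_segment (w i) (w (Suc i))"
      using that by (simp add: edge_def i)
    then show "x \<notin> closed_segment (w l) (w (Suc l))" if "l \<le> N - 1" "l \<noteq> i" for l
      using is_polygon_edges(2)[OF w i(2)] that by blast
  qed (use is_polygonD[OF w] i in auto)
  show ?thesis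
  proof
    assume n: "is_outward_normal N w j n"
    then have "norm n = 1" and "n \<bullet> u = 0"
      using du \<open>0 < norm d\<close> unfolding is_outward_normal_def i d_def[symmetric]
      by (auto simp flip: d_def) (metis inner_scaleR_right mult_eq_0_iff norm_eq_zero order_less_irrefl)
    define c where "c = cross2 u n"
    have "n = (u \<bullet> u) *\<^sub>R n"
      using nu by (simp add: norm_eq_1)
    also have "\<dots> = (n \<bullet> u) *\<^sub>R u + c *\<^sub>R (\<i> * u)"
      by (simp add: c_def complex_eq_iff inner_complex_def cross2_def algebra_simps)
    finally have nc: "n = c *\<^sub>R (\<i> * u)"
      using \<open>n \<bullet> u = 0\<close> by simp
    then have "\<bar>c\<bar> = 1"
      using \<open>norm n = 1\<close> nu by (simp add: norm_mult)
    moreover have "c \<noteq> 1"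
    proof
      assume "c = 1"
      have x: "midpoint (w i) (w (Suc i)) \<in> edge w j" (is "?x \<in> _")
        using neq by (simp add: edge_def i)
      have "\<forall>\<^sub>F e in at_right 0. ?x + e *\<^sub>R n \<in> outside (curve N w)"
        using n x by (simp add: is_outward_normal_def)
      with sides[OF x] have "\<forall>\<^sub>F e in at_right (0::real). False"
        by eventually_elim
          (metis IntI \<open>c = 1\<close> emptyE inside_Int_outside nc scaleR_one)
      then show False by simp
    qed
    ultimately have "c = - 1" by linarith
    then show "n = - \<i> * sgn (w j - w (j - 1))"
      using nc by (simp add: u_def d_def i)
  next
    assume n: "n = - \<i> * sgn (w j - w (j - 1))"
    then have n': "n = - \<i> * u" by (simp add: u_def d_def i)
    have "norm n = 1"
      using nu by (simp add: n' norm_mult)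
    moreover have "n \<bullet> d = 0"
      by (subst du) (simp add: n' inner_complex_def)
    moreover have "\<forall>x\<in>edge w j. \<forall>\<^sub>F e in at_right 0. x + e *\<^sub>R n \<in> outside (curve N w)"
      unfolding n' using sides eventually_mono by fast
    ultimately show "is_outward_normal N w j n"
      by (simp add: is_outward_normal_def i d_def)
  qed
qed

lemma outward_normal_eq:
  assumes "is_polygon N w" "j \<in> {1..N}"
  shows "outward_normal N w j = - \<i> * sgn (w j - w (j - 1))"
  unfolding outward_normal_def
  by (rule the_equality) (use is_outward_normal_iff[OF assms] in blast)+

section \<open>The area as a symmetric bilinear form\<close>

lemma area_shoelace:
  assumes w: "is_polygon N w"
  shows "area N w = (\<Sum>j=1..N. cross2 (w (j - 1)) (w j)) / 2"
proof -
  have "area N w = (\<Sum>i\<le>N - 1. cross2 (w i) (w (Suc i))) / 2"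
    unfolding area_def interior_domain_def curve_def boundary_path_def
    using is_polygonD[OF w] by (intro measure_inside_polyline) auto
  also have "(\<Sum>i\<le>N - 1. cross2 (w i) (w (Suc i))) = (\<Sum>j=1..N. cross2 (w (j - 1)) (w j))"
    using is_polygonD(1)[OF w]
    by (intro sum.reindex_bij_witness[of _ "\<lambda>j. j - 1" Suc]) auto
  finally show ?thesis .
qed

text \<open>
  For polygons with common normals this is twice the mixed area of \<open>w\<close> and \<open>v\<close>.
\<close>

definition mixed_sum :: "nat \<Rightarrow> polygon \<Rightarrow> polygon \<Rightarrow> real" where
  "mixed_sum N w v = (\<Sum>j=1..N. edge_length w j * height N v j)"

lemma height_initial_vertex:
  assumes "is_polygon N w" "j \<in> {1..N}"
  shows "height N w j = w (j - 1) \<bullet> outward_normal N w j"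
proof -
  have "is_outward_normal N w j (outward_normal N w j)"
    using is_outward_normal_iff[OF assms] outward_normal_eq[OF assms] by blast
  then have "(w j - w (j - 1)) \<bullet> outward_normal N w j = 0"
    by (simp add: is_outward_normal_def inner_commute)
  then show ?thesis
    by (simp add: height_def inner_diff_left)
qed

text \<open>
  The height of an edge may be measured at either of its end points, and a normal common to both
  polygons turns the edge length of \<open>w\<close> times the height of \<open>v\<close> into a cross product.  Having both
  versions is what makes the summation by parts for \<open>mixed_sum\<close> work.
\<close>

lemma edge_length_times_height:
  assumes "(w, v) \<in> polygon_equiv N" "j \<in> {1..N}"
  shows "edge_length w j * height N v j = cross2 (v j) (w j - w (j - 1))"
    and "edge_length w j * height N v j = cross2 (v (j - 1)) (w j - w (j - 1))"
proof -
  have w: "is_polygon N w" and v: "is_polygon N v"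
    and nn: "outward_normal N v j = outward_normal N w j"
    using assms by (auto simp: polygon_equiv_def)
  have "z = norm z *\<^sub>R sgn z" for z :: complex
    by (cases "z = 0") (simp_all add: sgn_div_norm)
  then have *: "edge_length w j * (a \<bullet> outward_normal N v j) = cross2 a (w j - w (j - 1))" for a
    unfolding nn outward_normal_eq[OF w assms(2)] inner_eq_cross2
    by (metis cross2_simps(3) edge_length_def dist_commute dist_norm)
  show "edge_length w j * height N v j = cross2 (v j) (w j - w (j - 1))"
    unfolding height_def by (rule *)
  show "edge_length w j * height N v j = cross2 (v (j - 1)) (w j - w (j - 1))"
    unfolding height_initial_vertex[OF v assms(2)] by (rule *)
qed

lemma sum_cyclic_shift:
  fixes f :: "nat \<Rightarrow> real"
  assumes "f N = f 0"
  shows "(\<Sum>j=1..N. f (j - 1)) = (\<Sum>j=1..N. f j)"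
proof -
  have "(\<Sum>j=1..n. f (j - 1)) + f n = (\<Sum>j=1..n. f j) + f 0" for n
    by (induction n) simp_all
  with assms show ?thesis by (metis add_right_cancel)
qed

lemma polygon_equiv_sym: "(w, v) \<in> polygon_equiv N \<Longrightarrow> (v, w) \<in> polygon_equiv N"
  by (simp add: polygon_equiv_def)

text \<open>
  Expressing the height at the initial vertex on one side and at the terminal vertex on the other,
  both sums consist of the terms \<open>cross2 (v (j - 1)) (w j)\<close> and of terms \<open>cross2 (v j) (w j)\<close>, which
  agree up to a cyclic shift of the index.
\<close>

lemma mixed_sum_commute:
  assumes wv: "(w, v) \<in> polygon_equiv N"
  shows "mixed_sum N w v = mixed_sum N v w"
proof -
  have w: "is_polygon N w" and v: "is_polygon N v"
    using wv by (auto simp: polygon_equiv_def)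
  have "mixed_sum N w v = (\<Sum>j=1..N. cross2 (v (j - 1)) (w j) - cross2 (v (j - 1)) (w (j - 1)))"
    unfolding mixed_sum_def by (simp add: edge_length_times_height(2)[OF wv] cross2_simps)
  also have "\<dots> = (\<Sum>j=1..N. cross2 (v (j - 1)) (w j)) - (\<Sum>j=1..N. cross2 (v j) (w j))"
    using sum_cyclic_shift[of "\<lambda>j. cross2 (v j) (w j)" N] is_polygonD(3)[OF w] is_polygonD(3)[OF v]
    by (simp add: sum_subtractf)
  also have "\<dots> = (\<Sum>j=1..N. cross2 (w j) (v j - v (j - 1)))"
    unfolding sum_subtractf[symmetric] by (intro sum.cong) (auto simp: cross2_simps cross2_skew[of "w _"])
  also have "\<dots> = mixed_sum N v w"
    unfolding mixed_sum_def using edge_length_times_height(1)[OF polygon_equiv_sym[OF wv]] by simp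
  finally show ?thesis .
qed

lemma area_mixed_sum:
  assumes w: "is_polygon N w"
  shows "area N w = mixed_sum N w w / 2"
proof -
  have ww: "(w, w) \<in> polygon_equiv N" using w by (simp add: polygon_equiv_def)
  show ?thesis
    unfolding mixed_sum_def area_shoelace[OF w] by (simp add: edge_length_times_height(2)[OF ww] cross2_simps)
qed

section \<open>Area differences within an equivalence class\<close>

lemma polygon_class_equiv:
  assumes "is_polygon_class N P" "w \<in> P" "v \<in> P"
  shows "(w, v) \<in> polygon_equiv N"
  using assms by (auto simp: is_polygon_class_def quotient_def polygon_equiv_def)

lemma polygon_class_is_polygon:
  assumes "is_polygon_class N P" "w \<in> P"
  shows "is_polygon N w"
  using polygon_class_equiv[OF assms assms(2)] by (simp add: polygon_equiv_def)

text \<open>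
  Symmetry makes the cross terms \<open>mixed_sum N w v\<close> and \<open>mixed_sum N v w\<close> cancel, so that the difference
  of two squares of a bilinear form factors as usual.
\<close>

lemma area_diff_eq_sum_heights:
  assumes "(w, v) \<in> polygon_equiv N"
  shows "area N v - area N w =
    (\<Sum>j=1..N. (edge_length w j + edge_length v j) / 2 * (height N v j - height N w j))"
proof -
  have "is_polygon N w" "is_polygon N v"
    using assms by (auto simp: polygon_equiv_def)
  then have "area N v - area N w = (mixed_sum N w v - mixed_sum N w w + mixed_sum N v v - mixed_sum N v w) / 2"
    using mixed_sum_commute[OF assms] by (simp add: area_mixed_sum)
  also have "\<dots> = (\<Sum>j=1..N. (edge_length w j + edge_length v j) / 2 * (height N v j - height N w j))"
    unfolding mixed_sum_def sum_subtractf[symmetric] sum.distrib[symmetric] sum_divide_distrib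
    by (intro sum.cong) (auto simp: field_simps)
  finally show ?thesis .
qed

text \<open>
  Symmetry moves the interpolation into the second argument, where \<open>mixed_sum\<close> depends only on the
  heights and averages them.  So the edge lengths of the interpolating polygon need not be computed.
\<close>

lemma area_diff_eq_midpoint_sum:
  assumes P: "is_polygon_class N P" "w \<in> P" "v \<in> P" and u: "is_interpolation N P w v u"
  shows "area N v - area N w = (\<Sum>j=1..N. edge_length u j * (height N v j - height N w j))"
proof -
  have "u \<in> P" and hu: "\<And>j. j \<in> {1..N} \<Longrightarrow> height N u j = (height N w j + height N v j) / 2"
    using u by (auto simp: is_interpolation_def)
  have mid: "mixed_sum N x u = (mixed_sum N x w + mixed_sum N x v) / 2" for x
    unfolding mixed_sum_def sum.distrib[symmetric] sum_divide_distrib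
    by (intro sum.cong) (auto simp: hu algebra_simps)
  have "(\<Sum>j=1..N. edge_length u j * (height N v j - height N w j)) = mixed_sum N u v - mixed_sum N u w"
    by (simp add: mixed_sum_def right_diff_distrib sum_subtractf)
  also have "\<dots> = mixed_sum N v u - mixed_sum N w u"
    using mixed_sum_commute[OF polygon_class_equiv[OF P(1) \<open>u \<in> P\<close> P(2)]]
      mixed_sum_commute[OF polygon_class_equiv[OF P(1) \<open>u \<in> P\<close> P(3)]] by simp
  also have "\<dots> = (mixed_sum N v v - mixed_sum N w w) / 2"
    using mixed_sum_commute[OF polygon_class_equiv[OF P]] by (simp add: mid field_simps)
  also have "\<dots> = area N v - area N w"
    using polygon_class_is_polygon[OF P(1)] P by (simp add: area_mixed_sum field_simps)
  finally show ?thesis by simp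
qed

section \<open>Area speed of a polygonal motion\<close>

text \<open>
  A point of the plane is recovered from its inner products with two linearly independent vectors.
  Applied to the normals of two adjacent edges, this recovers their common vertex from the heights.
\<close>

lemma scaleR_cross2_eq_dual_basis:
  "cross2 n m *\<^sub>R z = (z \<bullet> n) *\<^sub>R (- \<i> * m) + (z \<bullet> m) *\<^sub>R (\<i> * n)"
  by (simp add: complex_eq_iff cross2_def inner_complex_def algebra_simps)

text \<open>
  Adjacent edges have linearly independent normals, because an outer angle is neither zero nor \<open>pi\<close>.
\<close>

lemma cross2_sgn_neq_0:
  assumes "d \<noteq> 0" "e \<noteq> 0" "Arg (e / d) \<notin> {0, pi}"
  shows "cross2 (- \<i> * sgn d) (- \<i> * sgn e) \<noteq> 0"
proof
  assume "cross2 (- \<i> * sgn d) (- \<i> * sgn e) = 0"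
  moreover have "cross2 (- \<i> * x) (- \<i> * y) = cross2 x y" for x y
    by (simp add: cross2_def)
  ultimately have "cross2 (sgn d) (sgn e) = 0"
    by simp
  then have "cross2 d e = 0"
    using assms by (simp add: sgn_div_norm cross2_simps)
  then have "Im (e / d) = 0"
    by (simp add: Im_divide cross2_def algebra_simps)
  then have "e / d = of_real (Re (e / d))"
    by (simp add: complex_eq_iff)
  then have "Arg (e / d) \<in> {0, pi}"
    by (metis Arg_of_real insertCI)
  with assms(3) show False by simp
qed

lemma continuous_on_vertex:
  assumes P: "is_polygon_class N P" and mem: "\<And>t. t \<in> S \<Longrightarrow> G t \<in> P"
    and cont: "\<And>j. j \<in> {1..N} \<Longrightarrow> continuous_on S (\<lambda>t. height N (G t) j)"
    and j: "j \<in> {1..N}"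
  shows "continuous_on S (\<lambda>t. G t j)"
proof (cases "S = {}")
  case False
  then obtain t0 where t0: "t0 \<in> S" by blast
  \<comment> \<open>the edge following edge \<open>j\<close>, with cyclic numbering\<close>
  define l where "l = (if j = N then 1 else j + 1)"
  have pol: "is_polygon N (G t)" if "t \<in> S" for t
    using polygon_class_is_polygon[OF P mem[OF that]] .
  have l: "l \<in> {1..N}"
    using j is_polygonD(1)[OF pol[OF t0]] by (auto simp: l_def)
  define n m where "n = outward_normal N (G t0) j" and "m = outward_normal N (G t0) l"
  have normals: "outward_normal N (G t) j = n" "outward_normal N (G t) l = m" if "t \<in> S" for t
    using polygon_class_equiv[OF P mem[OF that] mem[OF t0]] j l
    by (auto simp: polygon_equiv_def n_def m_def)
  have edge_l: "w l - w (l - 1) = w (j + 1) - w j" "w (l - 1) = w j" if "is_polygon N w" for w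
    using is_polygonD(2)[OF that, of 1] is_polygonD(3)[OF that] by (auto simp: l_def add.commute)
  have neq: "G t0 i \<noteq> G t0 (i - 1)" if "i \<in> {1..N}" for i
  proof -
    have "i - 1 \<le> N - 1" "Suc (i - 1) = i"
      using that by auto
    with is_polygon_edges(1)[OF pol[OF t0]] show ?thesis
      by metis
  qed
  have "cross2 n m \<noteq> 0"
    unfolding n_def m_def outward_normal_eq[OF pol[OF t0] j] outward_normal_eq[OF pol[OF t0] l]
  proof (rule cross2_sgn_neq_0)
    show "Arg ((G t0 l - G t0 (l - 1)) / (G t0 j - G t0 (j - 1))) \<notin> {0, pi}"
      using is_polygonD(7)[OF pol[OF t0] j] unfolding outer_angle_def edge_l(1)[OF pol[OF t0]] .
  qed (use neq[OF j] neq[OF l] in simp_all)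
  have "G t j = (1 / cross2 n m) *\<^sub>R (height N (G t) j *\<^sub>R (- \<i> * m) + height N (G t) l *\<^sub>R (\<i> * n))"
    if "t \<in> S" for t
  proof -
    have "height N (G t) l = G t j \<bullet> m"
      using height_initial_vertex[OF pol[OF that] l] edge_l(2)[OF pol[OF that]]
      by (simp add: normals that)
    moreover have "height N (G t) j = G t j \<bullet> n"
      by (simp add: height_def normals that)
    ultimately have "cross2 n m *\<^sub>R G t j = height N (G t) j *\<^sub>R (- \<i> * m) + height N (G t) l *\<^sub>R (\<i> * n)"
      by (simp add: scaleR_cross2_eq_dual_basis)
    then show ?thesis
      using \<open>cross2 n m \<noteq> 0\<close> by (metis divide_self_if mult.commute scaleR_one scaleR_scaleR times_divide_eq_right mult_1_right)
  qed
  then show ?thesis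
    using cont[OF j] cont[OF l]
    by (subst continuous_on_cong[OF refl, where g = "\<lambda>t. (1 / cross2 n m) *\<^sub>R (height N (G t) j *\<^sub>R (- \<i> * m) + height N (G t) l *\<^sub>R (\<i> * n))"])
      (auto intro!: continuous_intros)
qed simp

lemma continuous_on_edge_length:
  assumes P: "is_polygon_class N P" and mem: "\<And>t. t \<in> S \<Longrightarrow> G t \<in> P"
    and cont: "\<And>j. j \<in> {1..N} \<Longrightarrow> continuous_on S (\<lambda>t. height N (G t) j)"
    and j: "j \<in> {1..N}"
  shows "continuous_on S (\<lambda>t. edge_length (G t) j)"
proof -
  have v: "continuous_on S (\<lambda>t. G t i)" if "i \<le> N" for i
  proof (cases "i = 0")
    case True
    \<comment> \<open>The first edge starts at the vertex with index zero, which is the one with index \<open>N\<close>.\<close>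
    have "continuous_on S (\<lambda>t. G t N)"
      using continuous_on_vertex[OF P mem cont, of N] j by auto
    moreover have "G t 0 = G t N" if "t \<in> S" for t
      using is_polygonD(3)[OF polygon_class_is_polygon[OF P mem[OF that]]] by simp
    ultimately show ?thesis
      using True by (simp cong: continuous_on_cong_simp)
  next
    case False
    then show ?thesis
      using continuous_on_vertex[OF P mem cont, of i] that by auto
  qed
  show ?thesis
    unfolding edge_length_def using j by (intro continuous_intros v) auto
qed

text \<open>
  In the difference quotient of the area, \<open>area_diff_eq_sum_heights\<close> leaves only height increments to
  be differentiated; the edge lengths need merely converge, which their continuity provides.
\<close>

lemma area_has_derivative_normal_velocity:
  assumes P: "is_polygon_class N P" and motion: "C1_polygonal_motion N P T G V" and t: "t \<in> {0..T}"
  shows "((\<lambda>s. area N (G s)) has_real_derivative (\<Sum>j=1..N. edge_length (G t) j * V t j)) (at t within {0..T})"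
proof -
  have mem: "\<And>s. s \<in> {0..T} \<Longrightarrow> G s \<in> P"
    and der: "\<And>j s. j \<in> {1..N} \<Longrightarrow> s \<in> {0..T} \<Longrightarrow>
      ((\<lambda>s. height N (G s) j) has_real_derivative V s j) (at s within {0..T})"
    using motion by (auto simp: C1_polygonal_motion_def)
  have "continuous_on {0..T} (\<lambda>s. height N (G s) j)" if "j \<in> {1..N}" for j
    using der[OF that] by (meson DERIV_continuous continuous_on_eq_continuous_within)
  from continuous_on_edge_length[OF P mem this]
  have len: "((\<lambda>s. edge_length (G s) j) \<longlongrightarrow> edge_length (G t) j) (at t within {0..T})" if "j \<in> {1..N}" for j
    using that t by (simp add: continuous_on_def)
  have "((\<lambda>s. \<Sum>j=1..N. (edge_length (G t) j + edge_length (G s) j) / 2 *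
        ((height N (G s) j - height N (G t) j) / (s - t))) \<longlongrightarrow>
      (\<Sum>j=1..N. (edge_length (G t) j + edge_length (G t) j) / 2 * V t j)) (at t within {0..T})"
    using der[OF _ t] unfolding has_field_derivative_iff
    by (intro tendsto_intros len) auto
  then have "((\<lambda>s. (area N (G s) - area N (G t)) / (s - t)) \<longlongrightarrow>
      (\<Sum>j=1..N. (edge_length (G t) j + edge_length (G t) j) / 2 * V t j)) (at t within {0..T})"
  proof (rule Lim_transform_eventually)
    show "\<forall>\<^sub>F s in at t within {0..T}.
      (\<Sum>j=1..N. (edge_length (G t) j + edge_length (G s) j) / 2 *
        ((height N (G s) j - height N (G t) j) / (s - t))) = (area N (G s) - area N (G t)) / (s - t)"
      unfolding eventually_at_filter
      using area_diff_eq_sum_heights[OF polygon_class_equiv[OF P mem[OF t] mem]]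
      by (intro always_eventually) (auto simp: sum_divide_distrib)
  qed
  then show ?thesis
    unfolding has_field_derivative_iff by simp
qed

lemma area_linear_of_constant_speed:
  assumes P: "is_polygon_class N P" and motion: "C1_polygonal_motion N P T G V"
    and speed: "\<And>t. t \<in> {0..T} \<Longrightarrow> (\<Sum>j=1..N. edge_length (G t) j * V t j) = \<mu>"
    and t: "t \<in> {0..T}"
  shows "area N (G t) = area N (G 0) + \<mu> * t"
proof -
  have "((\<lambda>s. area N (G s) - \<mu> * s) has_real_derivative 0) (at s within {0..T})" if "s \<in> {0..T}" for s
    using area_has_derivative_normal_velocity[OF P motion that] speed[OF that]
    by (auto intro!: derivative_eq_intros)
  then obtain c where "\<And>s. s \<in> {0..T} \<Longrightarrow> area N (G s) - \<mu> * s = c"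
    using has_field_derivative_zero_constant[of "{0..T}" "\<lambda>s. area N (G s) - \<mu> * s"] by auto
  from this[of t] this[of 0] t show ?thesis by auto
qed

section \<open>The implicit scheme and the area of the exact solution\<close>

theorem theorem4p2:
  fixes N mbar :: nat
    and P U :: "polygon set"
    and Tstar :: ereal
    and T \<mu> :: real
    and F :: "polygon \<Rightarrow> real \<Rightarrow> nat \<Rightarrow> real"
    and \<Gamma>star :: polygon
    and \<Gamma> \<Gamma>h :: "nat \<Rightarrow> polygon"
    and t :: "nat \<Rightarrow> real"
  assumes "is_polygon_class N P"
    and "U \<subseteq> P" and "openin (polygon_topology N P) U"
    and "0 < T" and "ereal T < Tstar"
    and "continuous_velocity N P U Tstar F"
    and "locally_lipschitz_velocity N P U Tstar F"
    and "\<forall>w\<in>U. \<forall>s\<in>time_domain Tstar. (\<Sum>j=1..N. edge_length w j * F w s j) = \<mu>"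
    and "\<Gamma>star \<in> U"
    and "t 0 = 0" and "\<forall>m<mbar. t m < t (m + 1)" and "t mbar \<le> T"
    and "is_scheme_solution N P U F mbar t \<Gamma>star \<Gamma> \<Gamma>h"
  shows "(\<forall>m<mbar. area N (\<Gamma> (m + 1)) = area N (\<Gamma> m) + \<mu> * (t (m + 1) - t m)) \<and>
         (\<forall>\<Gamma>ex. is_ivp_solution N P U F T \<Gamma>star \<Gamma>ex \<longrightarrow>
            (\<forall>m\<le>mbar. area N (\<Gamma> m) = area N (\<Gamma>ex (t m))))"
proof -
  note P = assms(1)
  have speed: "(\<Sum>j=1..N. edge_length w j * F w s j) = \<mu>" if "w \<in> U" "s \<in> {0..T}" for w s
  proof -
    have "ereal s < Tstar"
      using that(2) assms(5) by (metis atLeastAtMost_iff ereal_less_eq(3) le_less_trans)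
    then show ?thesis
      using that assms(8) by (auto simp: time_domain_def)
  qed
  have mono: "t m \<le> t m'" if "m \<le> m'" "m' \<le> mbar" for m m'
    using that
  proof (induction m' rule: dec_induct)
    case (step k)
    then show ?case using assms(11) by (force dest: spec[of _ k])
  qed simp
  have t_mem: "t m \<in> {0..T}" if "m \<le> mbar" for m
    using mono[of 0 m] mono[of m mbar] that assms(10,12) by simp
  have scheme: "\<Gamma> 0 = \<Gamma>star" "\<And>m. m \<in> {1..mbar} \<Longrightarrow> \<Gamma> m \<in> U"
    "\<And>m. m < mbar \<Longrightarrow> is_interpolation N P (\<Gamma> m) (\<Gamma> (m + 1)) (\<Gamma>h m)"
    "\<And>m. m < mbar \<Longrightarrow> \<Gamma>h m \<in> U"
    "\<And>m j. m < mbar \<Longrightarrow> j \<in> {1..N} \<Longrightarrow>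
        (height N (\<Gamma> (m + 1)) j - height N (\<Gamma> m) j) / (t (m + 1) - t m) = F (\<Gamma>h m) ((t m + t (m + 1)) / 2) j"
    using assms(13) by (auto simp: is_scheme_solution_def)
  have mem: "\<Gamma> m \<in> P" if "m \<le> mbar" for m
    using scheme(1) scheme(2)[of m] that assms(2,9) by (cases "m = 0") auto
  have step: "area N (\<Gamma> (m + 1)) = area N (\<Gamma> m) + \<mu> * (t (m + 1) - t m)" if "m < mbar" for m
  proof -
    have "t m < t (m + 1)" using assms(11) that by simp
    have "area N (\<Gamma> (m + 1)) - area N (\<Gamma> m) =
        (\<Sum>j=1..N. edge_length (\<Gamma>h m) j * (height N (\<Gamma> (m + 1)) j - height N (\<Gamma> m) j))"
      using that by (intro area_diff_eq_midpoint_sum[OF P mem mem scheme(3)]) simp_all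
    also have "\<dots> = (t (m + 1) - t m) *
        (\<Sum>j=1..N. edge_length (\<Gamma>h m) j * F (\<Gamma>h m) ((t m + t (m + 1)) / 2) j)"
      unfolding sum_distrib_left
    proof (rule sum.cong)
      fix j assume "j \<in> {1..N}"
      from scheme(5)[OF that this] \<open>t m < t (m + 1)\<close>
      have "height N (\<Gamma> (m + 1)) j - height N (\<Gamma> m) j =
          F (\<Gamma>h m) ((t m + t (m + 1)) / 2) j * (t (m + 1) - t m)"
        by (subst (asm) nonzero_divide_eq_eq) simp_all
      then show "edge_length (\<Gamma>h m) j * (height N (\<Gamma> (m + 1)) j - height N (\<Gamma> m) j) =
          (t (m + 1) - t m) * (edge_length (\<Gamma>h m) j * F (\<Gamma>h m) ((t m + t (m + 1)) / 2) j)"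
        by simp
    qed simp
    also have "\<dots> = (t (m + 1) - t m) * \<mu>"
      using t_mem[of m] t_mem[of "m + 1"] that by (subst speed) (auto simp: scheme(4))
    finally show ?thesis by (simp add: mult.commute)
  qed
  have linear: "area N (\<Gamma> m) = area N \<Gamma>star + \<mu> * t m" if "m \<le> mbar" for m
    using that
  proof (induction m)
    case (Suc m)
    then show ?case using step[of m] by (simp add: algebra_simps)
  qed (simp add: scheme(1) assms(10))
  have "area N (\<Gamma> m) = area N (\<Gamma>ex (t m))"
    if sol: "is_ivp_solution N P U F T \<Gamma>star \<Gamma>ex" and "m \<le> mbar" for \<Gamma>ex m
  proof -
    obtain V where V: "C1_polygonal_motion N P T \<Gamma>ex V"
      "\<And>s j. s \<in> {0..T} \<Longrightarrow> j \<in> {1..N} \<Longrightarrow> V s j = F (\<Gamma>ex s) s j"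
      and U: "\<Gamma>ex 0 = \<Gamma>star" "\<And>s. s \<in> {0..T} \<Longrightarrow> \<Gamma>ex s \<in> U"
      using sol by (auto simp: is_ivp_solution_def)
    have "area N (\<Gamma>ex (t m)) = area N (\<Gamma>ex 0) + \<mu> * t m"
    proof (rule area_linear_of_constant_speed[OF P V(1)])
      show "(\<Sum>j=1..N. edge_length (\<Gamma>ex s) j * V s j) = \<mu>" if "s \<in> {0..T}" for s
        using speed[OF U(2)[OF that] that] V(2)[OF that] by simp
    qed (rule t_mem[OF \<open>m \<le> mbar\<close>])
    then show ?thesis
      using linear[OF \<open>m \<le> mbar\<close>] U(1) by simp
  qed
  with step show ?thesis by blast
qed

end
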